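(* Let $a,b\in\mathbb{N}_0$ and let $\nu,k$ be positive integers. The number $c_{\nu,k}(an+b)$ of $(an+b)$-color compositions of $\nu$ with exactly $k$ parts is given by $$c_{\nu,k}(an+b)=\sum_{j=0}^{k} a^j b^{k-j}\binom{k}{j}\binom{\nu+j-1}{\nu-k}.$$ Thus the total number $W_\nu$ of $(an+b)$-color compositions of $\nu$ is $$W_\nu=\sum_{k=1}^{\nu}\sum_{j=0}^{k} a^j b^{k-j}\binom{k}{j}\binom{\nu+j-1}{\nu-k}.$$
   Context: $\mathbb{N}=\{1,2,3,\dots\}$ and $\mathbb{N}_0=\mathbb{N}\cup\{0\}$. A composition of a positive integer $\nu$ with $k$ parts is an ordered $k$-tuple $(j_1,\dots,j_k)$ of positive integers (called parts) with $j_1+\dots+j_k=\nu$. For a sequence $w=(w_n)_{n\in\mathbb{N}}$ of nonnegative integers, a $w$-color composition of $\nu$ is a composition of $\nu$ in which each part equal to $n$ is assigned one of $w_n$ available colors (if $w_n=0$, the integer $n$ is not used as a part). An $(an+b)$-color composition is a $w$-color composition for the sequence $w_n=an+b$, $n\ge 1$. Conventions: $0^0=1$, and $\binom{N}{r}=0$ for an integer $N\ge 0$ whenever $r<0$ or $r>N$. *)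

theory Defs
  imports Main
begin

definition composition :: "nat \<Rightarrow> nat list \<Rightarrow> bool" where
  "composition \<nu> xs \<longleftrightarrow> (\<forall>n\<in>set xs. 1 \<le> n) \<and> sum_list xs = \<nu>"

text \<open>A colored composition is a list of pairs \<open>(n, c)\<close> of a part and its color; the \<open>w n\<close>
  colors available for a part \<open>n\<close> are \<open>0, \<dots>, w n - 1\<close>. The value \<open>w 0\<close> is irrelevant.\<close>

definition color_compositions :: "(nat \<Rightarrow> nat) \<Rightarrow> nat \<Rightarrow> (nat \<times> nat) list set" where
  "color_compositions w \<nu> =
     {cs. composition \<nu> (map fst cs) \<and> (\<forall>(n, c)\<in>set cs. c < w n)}"

definition num_color_compositions :: "(nat \<Rightarrow> nat) \<Rightarrow> nat \<Rightarrow> nat" where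
  "num_color_compositions w \<nu> = card (color_compositions w \<nu>)"

definition num_color_compositions_parts :: "(nat \<Rightarrow> nat) \<Rightarrow> nat \<Rightarrow> nat \<Rightarrow> nat" where
  "num_color_compositions_parts w \<nu> k = card {cs \<in> color_compositions w \<nu>. length cs = k}"

text \<open>The lower index ranges over the integers: truncated subtraction on the natural numbers would
  turn a negative lower index into \<open>0\<close>, and the coefficient into \<open>1\<close> instead of \<open>0\<close>.\<close>

definition binom :: "nat \<Rightarrow> int \<Rightarrow> nat" where
  "binom N r = (if r < 0 then 0 else N choose nat r)"

lemma composition_length_le:
  assumes "composition \<nu> xs"
  shows "length xs \<le> \<nu>"
proof -
  have "(\<forall>n\<in>set xs. 1 \<le> n) \<Longrightarrow> length xs \<le> sum_list xs" for xs :: "nat list"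
    by (induction xs) auto
  with assms show ?thesis
    by (auto simp: composition_def)
qed

text \<open>Hence the cardinalities above are genuine counts.\<close>

lemma finite_color_compositions: "finite (color_compositions w \<nu>)"
proof (rule finite_subset)
  let ?A = "SIGMA n:{..\<nu>}. {..<w n}"
  show "color_compositions w \<nu> \<subseteq> {cs. set cs \<subseteq> ?A \<and> length cs \<le> \<nu>}"
  proof
    fix cs
    assume cs: "cs \<in> color_compositions w \<nu>"
    have "p \<in> ?A" if "p \<in> set cs" for p
    proof -
      have "fst p \<le> \<nu>"
        using cs that member_le_sum_list[of "fst p" "map fst cs"]
        by (auto simp: color_compositions_def composition_def)
      moreover have "snd p < w (fst p)"
        using cs that by (auto simp: color_compositions_def)
      ultimately show ?thesis
        by (cases p) auto
    qed
    moreover have "length cs \<le> \<nu>"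
      using cs composition_length_le[of \<nu> "map fst cs"] by (auto simp: color_compositions_def)
    ultimately show "cs \<in> {cs. set cs \<subseteq> ?A \<and> length cs \<le> \<nu>}"
      by blast
  qed
  show "finite {cs. set cs \<subseteq> ?A \<and> length cs \<le> \<nu>}"
    by (intro finite_lists_length_le finite_SigmaI) auto
qed

end

theory Submission
  imports Defs "HOL-Computational_Algebra.Formal_Power_Series"
begin

text \<open>
  The proof is a computation with ordinary generating functions. Prepending a colored part turns a
  composition with \<open>k\<close> parts into one with \<open>Suc k\<close> parts, so the \<open>w\<close>-color compositions with
  \<open>k\<close> parts are counted by the coefficients of \<open>F ^ k\<close>, where \<open>F = \<Sum>n\<ge>1. w n * X ^ n\<close>
  (\<open>num_color_compositions_parts_eq_power_nth\<close>).

  For \<open>w n = a * n + b\<close>, write \<open>E = \<Sum>n. X ^ n = 1 / (1 - X)\<close>. From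
  \<open>\<Sum>n. n * X ^ n = X * E ^ 2\<close> one gets the factorization \<open>F = X * E * (a * E + b)\<close>
  (\<open>color_fps_affine\<close>), and the binomial theorem expands \<open>F ^ k\<close> into the sum over \<open>j\<close> of
  \<open>(k choose j) * a ^ j * b ^ (k - j) * X ^ k * E ^ (k + j)\<close>. The coefficients of
  \<open>E ^ (k + j) = 1 / (1 - X) ^ (k + j)\<close> are binomial coefficients
  (\<open>geometric_fps_power_nth\<close>), which gives the formula for a fixed number of parts. The total is
  its sum over \<open>k\<close>, because a composition of \<open>\<nu> \<ge> 1\<close> has between \<open>1\<close> and \<open>\<nu>\<close> parts.

  Every series involved has nonnegative integer coefficients and no inverse has to be formed, so
  the whole computation takes place in power series over \<^typ>\<open>nat\<close>.
\<close>

text \<open>The value at \<open>0\<close> is set to \<open>0\<close> because \<open>w 0\<close> may be nonzero, although \<open>0\<close> is not a part.\<close>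

definition color_fps :: "(nat \<Rightarrow> nat) \<Rightarrow> nat fps" where
  "color_fps w = Abs_fps (\<lambda>n. if n = 0 then 0 else w n)"

definition geometric_fps :: "nat fps" where
  "geometric_fps = Abs_fps (\<lambda>_. 1)"

lemma color_compositions_length_0:
  "{cs \<in> color_compositions w \<nu>. length cs = 0} = (if \<nu> = 0 then {[]} else {})"
  by (auto simp: color_compositions_def composition_def)

lemma Cons_in_color_compositions:
  "(n, c) # cs \<in> color_compositions w \<nu> \<longleftrightarrow>
     n \<in> {1..\<nu>} \<and> c < w n \<and> cs \<in> color_compositions w (\<nu> - n)"
  by (auto simp: color_compositions_def composition_def)

text \<open>Removing the first colored part is a bijection, so the numbers of compositions satisfy the
  recurrence of the coefficients of the powers of a series: a convolution with the sequence \<open>w\<close>.\<close>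

lemma num_color_compositions_parts_Suc:
  "num_color_compositions_parts w \<nu> (Suc k) =
     (\<Sum>n=1..\<nu>. w n * num_color_compositions_parts w (\<nu> - n) k)"
proof -
  let ?P = "SIGMA n:{1..\<nu>}. {..<w n}"
  let ?S = "\<lambda>m. {cs \<in> color_compositions w m. length cs = k}"
  let ?C = "\<lambda>(p, cs). p # cs"
  have "{cs \<in> color_compositions w \<nu>. length cs = Suc k} = ?C ` (SIGMA p:?P. ?S (\<nu> - fst p))"
    by (force simp: length_Suc_conv Cons_in_color_compositions image_iff)
  moreover have "inj_on ?C (SIGMA p:?P. ?S (\<nu> - fst p))"
    by (auto simp: inj_on_def)
  ultimately have "num_color_compositions_parts w \<nu> (Suc k) = card (SIGMA p:?P. ?S (\<nu> - fst p))"
    by (simp add: num_color_compositions_parts_def card_image)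
  also have "\<dots> = (\<Sum>p\<in>?P. card (?S (\<nu> - fst p)))"
    by (intro card_SigmaI finite_SigmaI ballI) (auto simp: finite_color_compositions)
  also have "\<dots> = (\<Sum>(n, c)\<in>?P. card (?S (\<nu> - n)))"
    by (simp add: case_prod_unfold)
  also have "\<dots> = (\<Sum>n=1..\<nu>. \<Sum>c<w n. card (?S (\<nu> - n)))"
    by (subst sum.Sigma) auto
  finally show ?thesis
    by (simp add: num_color_compositions_parts_def)
qed

lemma num_color_compositions_parts_eq_power_nth:
  "num_color_compositions_parts w \<nu> k = fps_nth (color_fps w ^ k) \<nu>"
proof (induction k arbitrary: \<nu>)
  case 0
  show ?case
    unfolding num_color_compositions_parts_def color_compositions_length_0 by simp
next
  case (Suc k)
  have "fps_nth (color_fps w ^ Suc k) \<nu> =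
          (\<Sum>n=0..\<nu>. fps_nth (color_fps w) n * fps_nth (color_fps w ^ k) (\<nu> - n))"
    by (simp add: fps_mult_nth)
  also have "\<dots> = (\<Sum>n=1..\<nu>. w n * fps_nth (color_fps w ^ k) (\<nu> - n))"
    by (rule sum.mono_neutral_cong_right) (auto simp: color_fps_def)
  finally show ?case
    by (simp add: num_color_compositions_parts_Suc Suc.IH)
qed

text \<open>Multiplication by the geometric series forms partial sums of coefficients, so the induction
  step is the hockey-stick identity.\<close>

lemma geometric_fps_power_nth:
  "fps_nth (geometric_fps ^ Suc m) n = (m + n) choose n"
proof (induction m arbitrary: n)
  case 0
  show ?case
    by (simp add: geometric_fps_def)
next
  case (Suc m)
  have "fps_nth (geometric_fps ^ Suc (Suc m)) n =
          (\<Sum>i=0..n. fps_nth (geometric_fps ^ Suc m) i * fps_nth geometric_fps (n - i))"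
    by (simp only: power_Suc2[of _ "Suc m"] fps_mult_nth)
  also have "\<dots> = (\<Sum>i\<le>n. (m + i) choose i)"
    by (simp only: Suc.IH) (simp add: geometric_fps_def atMost_atLeast0)
  also have "\<dots> = (Suc m + n) choose n"
    by (simp add: sum_choose_lower)
  finally show ?case .
qed

lemma color_fps_affine:
  "color_fps (\<lambda>n. a * n + b) =
     fps_X * geometric_fps * (of_nat a * geometric_fps + of_nat b)"
proof (rule fps_ext)
  fix n
  have E2: "fps_nth (geometric_fps * geometric_fps) m = Suc m" for m
    using geometric_fps_power_nth[of 1 m] by (simp add: power2_eq_square)
  have "fps_X * geometric_fps * (of_nat a * geometric_fps + of_nat b) =
          fps_X * (of_nat a * (geometric_fps * geometric_fps) + of_nat b * geometric_fps)"
    by (simp add: algebra_simps)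
  then show "fps_nth (color_fps (\<lambda>n. a * n + b)) n =
      fps_nth (fps_X * geometric_fps * (of_nat a * geometric_fps + of_nat b)) n"
    by (cases n) (simp_all add: color_fps_def fps_of_nat[symmetric] E2, simp add: geometric_fps_def)
qed

lemma color_fps_affine_power:
  "color_fps (\<lambda>n. a * n + b) ^ k =
     fps_X ^ k * (\<Sum>j=0..k. of_nat (a ^ j * b ^ (k - j) * (k choose j)) * geometric_fps ^ (k + j))"
proof -
  have "color_fps (\<lambda>n. a * n + b) ^ k =
          fps_X ^ k * (geometric_fps ^ k * (of_nat a * geometric_fps + of_nat b) ^ k)"
    by (simp add: color_fps_affine power_mult_distrib mult.assoc)
  also have "geometric_fps ^ k * (of_nat a * geometric_fps + of_nat b) ^ k =
      (\<Sum>j=0..k. of_nat (a ^ j * b ^ (k - j) * (k choose j)) * geometric_fps ^ (k + j))"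
    by (simp add: binomial_ring sum_distrib_left power_mult_distrib power_add mult_ac
        atMost_atLeast0)
  finally show ?thesis .
qed

text \<open>For \<open>k > \<nu>\<close> both sides vanish: the left one because of the factor \<open>X ^ k\<close>, the right one
  because the lower index of \<^const>\<open>binom\<close> is negative.\<close>

lemma num_affine_color_compositions_parts:
  "num_color_compositions_parts (\<lambda>n. a * n + b) \<nu> k =
     (\<Sum>j=0..k. a ^ j * b ^ (k - j) * (k choose j) * binom (\<nu> + j - 1) (int \<nu> - int k))"
proof (cases "k \<le> \<nu>")
  case False
  then show ?thesis
    by (simp add: num_color_compositions_parts_eq_power_nth color_fps_affine_power
        fps_X_power_mult_nth binom_def)
next
  case True
  have E: "fps_nth (geometric_fps ^ (k + j)) (\<nu> - k) = binom (\<nu> + j - 1) (int \<nu> - int k)" for j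
  proof (cases "k + j = 0")
    case True
    \<comment> \<open>Here \<open>E ^ 0 = 1\<close>, which agrees with \<open>(\<nu> - 1) choose \<nu>\<close>; the truncated \<open>\<nu> - 1\<close> is right
      for \<open>\<nu> = 0\<close> too.\<close>
    then show ?thesis
      by (cases \<nu>) (simp_all add: binom_def)
  next
    case False
    have "Suc (k + j - 1) = k + j" "k + j - 1 + (\<nu> - k) = \<nu> + j - 1" "nat (int \<nu> - int k) = \<nu> - k"
      using False \<open>k \<le> \<nu>\<close> by auto
    then show ?thesis
      using geometric_fps_power_nth[of "k + j - 1" "\<nu> - k"] \<open>k \<le> \<nu>\<close> by (simp add: binom_def)
  qed
  have "num_color_compositions_parts (\<lambda>n. a * n + b) \<nu> k =
      (\<Sum>j=0..k. fps_nth (of_nat (a ^ j * b ^ (k - j) * (k choose j)) * geometric_fps ^ (k + j)) (\<nu> - k))"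
    using True by (simp add: num_color_compositions_parts_eq_power_nth color_fps_affine_power
        fps_X_power_mult_nth fps_sum_nth del: of_nat_mult of_nat_power)
  also have "\<dots> = (\<Sum>j=0..k. a ^ j * b ^ (k - j) * (k choose j) * binom (\<nu> + j - 1) (int \<nu> - int k))"
    by (simp only: fps_of_nat[symmetric] fps_mult_left_const_nth E of_nat_id)
  finally show ?thesis .
qed

lemma num_color_compositions_eq_sum_parts:
  assumes "\<nu> \<ge> 1"
  shows "num_color_compositions w \<nu> = (\<Sum>k=1..\<nu>. num_color_compositions_parts w \<nu> k)"
proof -
  have "length cs \<in> {1..\<nu>}" if "cs \<in> color_compositions w \<nu>" for cs
    using that assms composition_length_le[of \<nu> "map fst cs"]
    by (cases cs) (auto simp: color_compositions_def composition_def)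
  then have "color_compositions w \<nu> =
      (\<Union>k\<in>{1..\<nu>}. {cs \<in> color_compositions w \<nu>. length cs = k})"
    by auto
  then have "num_color_compositions w \<nu> =
      card (\<Union>k\<in>{1..\<nu>}. {cs \<in> color_compositions w \<nu>. length cs = k})"
    by (simp add: num_color_compositions_def)
  also have "\<dots> = (\<Sum>k=1..\<nu>. card {cs \<in> color_compositions w \<nu>. length cs = k})"
    by (rule card_UN_disjoint) (auto simp: finite_color_compositions)
  finally show ?thesis
    by (simp add: num_color_compositions_parts_def)
qed

theorem theorem2:
  fixes a b \<nu> :: nat
  assumes "\<nu> \<ge> 1"
  shows "(\<forall>k\<ge>1. num_color_compositions_parts (\<lambda>n. a * n + b) \<nu> k =
            (\<Sum>j=0..k. a ^ j * b ^ (k - j) * (k choose j) * binom (\<nu> + j - 1) (int \<nu> - int k)))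
       \<and> num_color_compositions (\<lambda>n. a * n + b) \<nu> =
            (\<Sum>k=1..\<nu>. \<Sum>j=0..k. a ^ j * b ^ (k - j) * (k choose j) * binom (\<nu> + j - 1) (int \<nu> - int k))"
  using assms
  by (auto simp: num_color_compositions_eq_sum_parts num_affine_color_compositions_parts
      intro!: sum.cong)

end
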